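(* Let $\mathsf{n}$ be a tuple of linear subspaces of a finite-dimensional vector space $V$ over a field $\mathbb{K}$. All bases of the Minkowski matroid $\mathsf{M}(\mathsf{n})$ have the same defect, and this common defect is non-negative.
   Context: A tuple is a finite indexed family of linear subspaces of $V$ (repetitions allowed); a subtuple is a subfamily indexed by a subset of the index set. For a tuple $\mathsf{k}$, its linear span is $\langle\mathsf{k}\rangle=\sum_{L\in\mathsf{k}}L$ (zero for the empty tuple), its cardinality $\mathfrak{c}(\mathsf{k})$ is the number of its entries, and its defect is $\delta(\mathsf{k})=\dim\langle\mathsf{k}\rangle-\mathfrak{c}(\mathsf{k})$. A tuple is linearly independent if every subtuple of it (including itself) has non-negative defect. The Minkowski matroid $\mathsf{M}(\mathsf{n})$ has as ground set the entries (indices) of $\mathsf{n}$ and as independent sets the linearly independent subtuples of $\mathsf{n}$; its bases are the maximal linearly independent subtuples. *)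

theory Defs
  imports HOL.Vector_Spaces "HOL-Library.Set_Algebras"
begin

text \<open>
  A tuple of subspaces is a family \<open>L :: 'i \<Rightarrow> 'v set\<close> over a finite index set \<open>I\<close>
  (so entries may repeat); its subtuples are the subfamilies indexed by subsets of \<open>I\<close>.
\<close>

text \<open>The sum is the sum of sets of \<^theory>\<open>HOL-Library.Set_Algebras\<close>; for empty \<open>J\<close> it is \<open>{0}\<close>.\<close>

definition tuple_span :: "('i \<Rightarrow> 'v set) \<Rightarrow> 'i set \<Rightarrow> ('v::ab_group_add) set"
  where "tuple_span L J = (\<Sum>i\<in>J. L i)"

definition tuple_defect ::
    "('k::field \<Rightarrow> 'v::ab_group_add \<Rightarrow> 'v) \<Rightarrow> ('i \<Rightarrow> 'v set) \<Rightarrow> 'i set \<Rightarrow> int"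
  where "tuple_defect scale L J = int (vector_space.dim scale (tuple_span L J)) - int (card J)"

definition tuple_independent ::
    "('k::field \<Rightarrow> 'v::ab_group_add \<Rightarrow> 'v) \<Rightarrow> ('i \<Rightarrow> 'v set) \<Rightarrow> 'i set \<Rightarrow> bool"
  where "tuple_independent scale L J \<longleftrightarrow> (\<forall>K\<subseteq>J. 0 \<le> tuple_defect scale L K)"

text \<open>A matroid is represented by the pair of its ground set and its family of independent sets.\<close>

definition minkowski_matroid ::
    "('k::field \<Rightarrow> 'v::ab_group_add \<Rightarrow> 'v) \<Rightarrow> 'i set \<Rightarrow> ('i \<Rightarrow> 'v set) \<Rightarrow> 'i set \<times> 'i set set"
  where "minkowski_matroid scale I L = (I, {J. J \<subseteq> I \<and> tuple_independent scale L J})"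

definition matroid_bases :: "'i set \<times> 'i set set \<Rightarrow> 'i set set"
  where "matroid_bases M = {B \<in> snd M. \<forall>J\<in>snd M. B \<subseteq> J \<longrightarrow> J = B}"

text \<open>For subspaces, the sum of sets is the linear span of the union.\<close>

lemma (in vector_space) tuple_span_eq_span:
  assumes "finite J" and "\<And>i. i \<in> J \<Longrightarrow> subspace (L i)"
  shows "tuple_span L J = span (\<Union>i\<in>J. L i)"
  using assms
proof (induction J rule: finite_induct)
  case empty
  then show ?case by (simp add: tuple_span_def)
next
  case (insert a J)
  have "tuple_span L (insert a J) = L a + tuple_span L J"
    using insert by (simp add: tuple_span_def)
  also have "\<dots> = span (L a) + span (\<Union>i\<in>J. L i)"
    using insert by (simp add: span_eq_iff[THEN iffD2])
  also have "\<dots> = span (L a \<union> (\<Union>i\<in>J. L i))"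
    by (auto simp: span_Un set_plus_def)
  finally show ?case by simp
qed

end

theory Submission
  imports Defs
begin

text \<open>
  Submodularity of the dimension makes the zero-defect subtuples of an independent tuple closed
  under union. If \<open>B\<close> is a basis and \<open>T \<subseteq> B\<close> is its largest zero-defect subtuple, maximality of
  \<open>B\<close> forces every entry outside \<open>B\<close> to lie in the span of \<open>T\<close>. Hence \<open>B\<close> spans the same space
  as the whole tuple. Moreover an independent subtuple \<open>J\<close> has at most \<open>dim \<langle>T\<rangle> = card T\<close> entries
  that are outside \<open>B\<close> or in \<open>T\<close>, the others being in \<open>B - T\<close>, so \<open>card J \<le> card B\<close>.
\<close>

lemma minkowski_matroid_bases_iff:
  "B \<in> matroid_bases (minkowski_matroid scale I L) \<longleftrightarrow>
    B \<subseteq> I \<and> tuple_independent scale L B \<and>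
    (\<forall>J. B \<subseteq> J \<and> J \<subseteq> I \<and> tuple_independent scale L J \<longrightarrow> J = B)"
  unfolding matroid_bases_def minkowski_matroid_def by auto

context finite_dimensional_vector_space
begin

text \<open>The dimension formula for sums of subspaces, carried over to generating sets, since a
  set and its span have the same \<open>dim\<close>.\<close>

lemma dim_Un_Int: "dim (S \<union> T) + dim (span S \<inter> span T) = dim S + dim T"
  using dim_sums_Int[of "span S" "span T"] by (simp flip: span_Un)

lemma tuple_defect_eq:
  assumes "finite J" and "\<And>i. i \<in> J \<Longrightarrow> subspace (L i)"
  shows "tuple_defect scale L J = int (dim (\<Union>i\<in>J. L i)) - int (card J)"
  using assms by (simp add: tuple_defect_def tuple_span_eq_span)

text \<open>Cardinality is modular, so only dimension matters. The inequality can be strict because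
  the entries common to \<open>J\<close> and \<open>K\<close> may span less than the intersection of
  the two spans.\<close>

lemma tuple_defect_submodular:
  assumes "finite J" "finite K" and "\<And>i. i \<in> J \<union> K \<Longrightarrow> subspace (L i)"
  shows "tuple_defect scale L (J \<union> K) + tuple_defect scale L (J \<inter> K)
    \<le> tuple_defect scale L J + tuple_defect scale L K"
proof -
  let ?U = "\<lambda>J. \<Union>i\<in>J. L i"
  have "?U (J \<inter> K) \<subseteq> span (?U J) \<inter> span (?U K)"
    by (auto intro: span_base)
  then have "dim (?U (J \<inter> K)) \<le> dim (span (?U J) \<inter> span (?U K))"
    by (rule dim_subset)
  with dim_Un_Int[of "?U J" "?U K"]
  have "dim (?U (J \<union> K)) + dim (?U (J \<inter> K)) \<le> dim (?U J) + dim (?U K)"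
    by (simp add: UN_Un)
  moreover have "tuple_defect scale L A = int (dim (?U A)) - int (card A)" if "A \<subseteq> J \<union> K" for A
    using that assms finite_subset[OF that] by (intro tuple_defect_eq) auto
  ultimately show ?thesis
    using card_Un_Int[OF assms(1,2)] by (simp add: le_infI1)
qed

lemma tuple_independent_card_le:
  assumes "tuple_independent scale L J" "finite J" and "\<And>i. i \<in> J \<Longrightarrow> subspace (L i)"
    and "K \<subseteq> J" and "\<And>i. i \<in> K \<Longrightarrow> L i \<subseteq> span S"
  shows "card K \<le> dim S"
proof -
  have "finite K"
    using assms(2,4) finite_subset by blast
  then have "tuple_defect scale L K = int (dim (\<Union>i\<in>K. L i)) - int (card K)"
    using assms(3,4) by (intro tuple_defect_eq) auto
  moreover have "0 \<le> tuple_defect scale L K"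
    using assms(1,4) by (simp add: tuple_independent_def)
  ultimately have "card K \<le> dim (\<Union>i\<in>K. L i)"
    by simp
  also have "\<dots> \<le> dim (span S)"
    using assms(5) by (intro dim_subset) blast
  finally show ?thesis
    by simp
qed

text \<open>A subtuple of negative defect must contain \<open>j\<close>, as \<open>B\<close> is
  independent. Deleting \<open>j\<close> raises the defect by at most one, and the result is
  non-negative, so it is exactly zero and the deletion loses no dimension.\<close>

lemma tuple_circuit_tight:
  assumes B: "tuple_independent scale L B" "finite B"
    and L: "\<And>i. i \<in> insert j B \<Longrightarrow> subspace (L i)"
    and dep: "\<not> tuple_independent scale L (insert j B)"
  obtains T where "T \<subseteq> B" "tuple_defect scale L T = 0" "L j \<subseteq> span (\<Union>i\<in>T. L i)"
proof -
  obtain K where K: "K \<subseteq> insert j B" "tuple_defect scale L K < 0"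
    using dep by (auto simp: tuple_independent_def not_le)
  have "\<not> K \<subseteq> B"
    using B(1) K(2) by (auto simp: tuple_independent_def)
  with K(1) have "j \<in> K"
    by blast
  define T where "T = K - {j}"
  have T: "T \<subseteq> B" "K = insert j T" "j \<notin> T" "finite T"
    using K(1) \<open>j \<in> K\<close> B(2) finite_subset[of T B] by (auto simp: T_def)
  have "0 \<le> tuple_defect scale L T"
    using B(1) T(1) by (simp add: tuple_independent_def)
  have dT: "tuple_defect scale L T = int (dim (\<Union>i\<in>T. L i)) - int (card T)"
    using T L by (intro tuple_defect_eq) auto
  have dK: "tuple_defect scale L K = int (dim (\<Union>i\<in>K. L i)) - int (card K)"
    using T L by (intro tuple_defect_eq) auto
  have card: "card K = Suc (card T)"
    using T by simp
  have sub: "(\<Union>i\<in>T. L i) \<subseteq> (\<Union>i\<in>K. L i)"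
    using T by auto
  have "tuple_defect scale L T = 0"
    using dim_subset[OF sub] dT dK card K(2) \<open>0 \<le> tuple_defect scale L T\<close> by linarith
  \<comment> \<open>Negative defect gives \<open>dim\<close> of \<open>K\<close> at most
    \<open>card K - 1 = card T\<close>, which is at most \<open>dim\<close> of \<open>T\<close>;
    nested sets with this bound have equal spans.\<close>
  moreover have "span (\<Union>i\<in>T. L i) = span (\<Union>i\<in>K. L i)"
    using dT dK card K(2) \<open>0 \<le> tuple_defect scale L T\<close> by (intro dim_eq_span[OF sub]) linarith
  then have "L j \<subseteq> span (\<Union>i\<in>T. L i)"
    using \<open>j \<in> K\<close> span_superset by fastforce
  ultimately show thesis
    using that T(1) by blast
qed

text \<open>The point is uniformity: each \<open>j\<close> outside \<open>B\<close> has its own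
  zero-defect subtuple, and a single \<open>T\<close> containing all of these serves every
  \<open>j\<close> at once.\<close>

lemma minkowski_matroid_basis_tight:
  assumes I: "finite I" and L: "\<And>i. i \<in> I \<Longrightarrow> subspace (L i)"
    and B: "B \<in> matroid_bases (minkowski_matroid scale I L)"
  obtains T where "T \<subseteq> B" "tuple_defect scale L T = 0"
    "\<forall>j\<in>I - B. L j \<subseteq> span (\<Union>i\<in>T. L i)"
proof -
  have BI: "B \<subseteq> I" and ind: "tuple_independent scale L B"
    using B by (simp_all add: minkowski_matroid_bases_iff)
  have finB: "finite B"
    using BI I finite_subset by blast
  define F where "F = {T. T \<subseteq> B \<and> tuple_defect scale L T = 0}"
  have "finite F"
    using finB by (auto simp: F_def intro: finite_subset[of _ "Pow B"])
  moreover have "{} \<in> F"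
    using tuple_defect_eq[of "{}" L] by (simp add: F_def)
  ultimately obtain T where T: "T \<in> F" and T_max: "\<And>K. K \<in> F \<Longrightarrow> T \<subseteq> K \<Longrightarrow> T = K"
    using finite_has_maximal[of F] by blast
  \<comment> \<open>By submodularity the defects of \<open>K \<union> T\<close> and
    \<open>K \<inter> T\<close> have sum at most zero; both are non-negative, so both vanish. Thus
    \<open>K \<union> T\<close> is in \<open>F\<close>, and maximality of \<open>T\<close> absorbs
    \<open>K\<close>.\<close>
  have T_greatest: "K \<subseteq> T" if "K \<in> F" for K
  proof -
    have "finite K" "finite T" "K \<union> T \<subseteq> B"
      using that T finB finite_subset by (auto simp: F_def)
    then have "tuple_defect scale L (K \<union> T) + tuple_defect scale L (K \<inter> T) \<le> 0"
      using tuple_defect_submodular[of K T L] that T L BI by (auto simp: F_def)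
    moreover have "0 \<le> tuple_defect scale L (K \<union> T)" "0 \<le> tuple_defect scale L (K \<inter> T)"
      using ind \<open>K \<union> T \<subseteq> B\<close> by (simp_all add: tuple_independent_def le_infI1)
    ultimately have "K \<union> T \<in> F"
      using \<open>K \<union> T \<subseteq> B\<close> by (simp add: F_def)
    then show ?thesis
      using T_max by blast
  qed
  have "L j \<subseteq> span (\<Union>i\<in>T. L i)" if j: "j \<in> I - B" for j
  proof -
    have "B \<subseteq> insert j B" "insert j B \<subseteq> I" "insert j B \<noteq> B"
      using j BI by auto
    then have dep: "\<not> tuple_independent scale L (insert j B)"
      using B unfolding minkowski_matroid_bases_iff by metis
    have "subspace (L i)" if "i \<in> insert j B" for i
      using L \<open>insert j B \<subseteq> I\<close> that by blast
    from tuple_circuit_tight[OF ind finB this dep]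
    obtain K where "K \<subseteq> B" "tuple_defect scale L K = 0" and K: "L j \<subseteq> span (\<Union>i\<in>K. L i)" .
    then have "K \<subseteq> T"
      by (intro T_greatest) (simp add: F_def)
    then have "span (\<Union>i\<in>K. L i) \<subseteq> span (\<Union>i\<in>T. L i)"
      by (intro span_mono) blast
    with K show ?thesis
      by blast
  qed
  with T show thesis
    by (intro that[of T]) (simp_all add: F_def)
qed

lemma minkowski_matroid_basis_dim:
  assumes "finite I" and "\<And>i. i \<in> I \<Longrightarrow> subspace (L i)"
    and B: "B \<in> matroid_bases (minkowski_matroid scale I L)"
  shows "dim (\<Union>i\<in>B. L i) = dim (\<Union>i\<in>I. L i)"
proof -
  from minkowski_matroid_basis_tight[OF assms]
  obtain T where T: "T \<subseteq> B" "tuple_defect scale L T = 0"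
    "\<forall>j\<in>I - B. L j \<subseteq> span (\<Union>i\<in>T. L i)" .
  have "span (\<Union>i\<in>T. L i) \<subseteq> span (\<Union>i\<in>B. L i)"
    using T(1) by (intro span_mono) blast
  then have "L j \<subseteq> span (\<Union>i\<in>B. L i)" if "j \<in> I" for j
    using T(3) that by (cases "j \<in> B") (auto intro: span_base)
  then have "dim (\<Union>i\<in>I. L i) \<le> dim (span (\<Union>i\<in>B. L i))"
    by (intro dim_subset) blast
  moreover have "B \<subseteq> I"
    using B by (simp_all add: minkowski_matroid_bases_iff)
  then have "dim (\<Union>i\<in>B. L i) \<le> dim (\<Union>i\<in>I. L i)"
    by (intro dim_subset) blast
  ultimately show ?thesis
    by simp
qed

text \<open>A direct count takes the place of an exchange argument. Applied to two bases in both
  orders, it makes their cardinalities equal.\<close>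

lemma minkowski_matroid_basis_card_ge:
  assumes I: "finite I" and L: "\<And>i. i \<in> I \<Longrightarrow> subspace (L i)"
    and B: "B \<in> matroid_bases (minkowski_matroid scale I L)"
    and J: "J \<subseteq> I" "tuple_independent scale L J"
  shows "card J \<le> card B"
proof -
  from minkowski_matroid_basis_tight[OF I L B]
  obtain T where T: "T \<subseteq> B" "tuple_defect scale L T = 0"
    "\<forall>j\<in>I - B. L j \<subseteq> span (\<Union>i\<in>T. L i)" .
  have "B \<subseteq> I"
    using B by (simp_all add: minkowski_matroid_bases_iff)
  then have fin: "finite J" "finite B" "finite T"
    using J(1) T(1) I by (auto intro: finite_subset)
  \<comment> \<open>The part of \<open>J\<close> that lies in \<open>span\<close> of
    \<open>T\<close>: its entries are in \<open>T\<close> or outside \<open>B\<close>. The rest of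
    \<open>J\<close> is inside \<open>B - T\<close>.\<close>
  let ?K = "J - (B - T)"
  have "L i \<subseteq> span (\<Union>i\<in>T. L i)" if "i \<in> ?K" for i
    using T(3) J(1) that by (cases "i \<in> T") (auto intro: span_base)
  then have "card ?K \<le> dim (\<Union>i\<in>T. L i)"
    using J(1) by (intro tuple_independent_card_le[OF J(2) fin(1) L]) auto
  \<comment> \<open>Zero defect of \<open>T\<close> turns the dimension bound into a
    cardinality.\<close>
  also have "\<dots> = card T"
    using tuple_defect_eq[of T L] T(1,2) fin(3) \<open>B \<subseteq> I\<close> L by (simp add: subset_iff)
  finally have "card (?K \<union> (B - T)) \<le> card T + card (B - T)"
    using card_Un_le[of ?K "B - T"] by linarith
  moreover have "card J \<le> card (?K \<union> (B - T))"
    using fin by (intro card_mono) auto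
  moreover have "card T + card (B - T) = card B"
    using T(1) fin by (simp add: card_Diff_subset card_mono)
  ultimately show ?thesis
    by linarith
qed

end

theorem theorem1p24:
  fixes scale :: "'k::field \<Rightarrow> 'v::ab_group_add \<Rightarrow> 'v"
    and Basis :: "'v set"
    and I :: "'i set"
    and L :: "'i \<Rightarrow> 'v set"
  assumes "finite_dimensional_vector_space scale Basis"
    and "finite I"
    and "\<And>i. i \<in> I \<Longrightarrow> module.subspace scale (L i)"
  shows "\<exists>d\<ge>0. \<forall>B \<in> matroid_bases (minkowski_matroid scale I L).
           tuple_defect scale L B = d"
proof -
  interpret finite_dimensional_vector_space scale Basis
    by fact
  let ?Bs = "matroid_bases (minkowski_matroid scale I L)"
  have basis: "B \<subseteq> I" "tuple_independent scale L B" if "B \<in> ?Bs" for B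
    using that by (simp_all add: minkowski_matroid_bases_iff)
  \<comment> \<open>The dimension term is now the same for all bases, so only their cardinalities
    remain to be compared.\<close>
  have defect: "tuple_defect scale L B = int (dim (\<Union>i\<in>I. L i)) - int (card B)" if "B \<in> ?Bs" for B
    using basis(1)[OF that] assms(2,3) finite_subset[of B I]
      minkowski_matroid_basis_dim[OF assms(2,3) that] tuple_defect_eq[of B L] by (simp add: subset_iff)
  have "card C \<le> card B" if "B \<in> ?Bs" "C \<in> ?Bs" for B C
    using minkowski_matroid_basis_card_ge[OF assms(2,3) that(1) basis[OF that(2)]] .
  then have eq: "tuple_defect scale L B = tuple_defect scale L C" if "B \<in> ?Bs" "C \<in> ?Bs" for B C
    using defect that by (simp add: order_antisym)
  show ?thesis
  \<comment> \<open>A basis supplies the witness \<open>d\<close> and its sign; with no basis the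
    claim is vacuous and any non-negative \<open>d\<close> will do.\<close>
  proof (cases "?Bs = {}")
    case False
    then obtain B where B: "B \<in> ?Bs"
      by blast
    then have "0 \<le> tuple_defect scale L B"
      using basis(2) by (simp add: tuple_independent_def)
    with B eq show ?thesis
      by blast
  qed auto
qed

end
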